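(* Let $\mathcal{P}$ be a persistent clique partition of a metric space $(X,d)$, let $\mathcal{M}$ be the maximal-clique cover of $(X,d)$, let $\mathcal{M}_Q(r)$ be the maximal-clique cover at scale $r$ of the quotient space $(X/\mathcal{P}(r),d_{\mathcal{P}(r)})$, and let $\mathcal{M}_Q^{\mathcal{P}}(r)=q_r^*(\mathcal{M}_Q(r))$ be its pullback cover on $X$. Then $\mathcal{M}$ and $\mathcal{M}_Q^{\mathcal{P}}$ are $3$-approximated up to contiguity.
   Context: $\mathbb{R}_+=[0,\infty)$. A cover of a set $X$ is an indexed family $\mathcal{U}=\{U_i\}_{i\in I}$ of sets with $X=\bigcup_{i\in I}U_i$. A refinement map $\{V_j\}_{j\in J}\to\{U_i\}_{i\in I}$ is a function $f:J\to I$ with $V_j\subseteq U_{f(j)}$ for all $j$. For a set $Y$ with a symmetric dissimilarity $\delta\ge0$ vanishing on the diagonal (the triangle inequality is not required), a subset $M\subseteq Y$ is an $r$-clique if $\delta(x,y)\le r$ for all $x,y\in M$, and is maximal if not properly contained in another $r$-clique; the maximal-clique cover at scale $r$ is the cover of $Y$ by all maximal $r$-cliques. $\mathcal{M}(r)$ is the maximal-clique cover of $(X,d)$ at scale $r$. A persistent clique partition $\mathcal{P}$ of $X$ assigns to each $r\in\mathbb{R}_+$ a partition $\mathcal{P}(r)$ of $X$ (into nonempty blocks) such that every block $C\in\mathcal{P}(r)$ has $\mathrm{diam}(C)\le r$, and for $s\le t$ every block of $\mathcal{P}(s)$ is contained in a block of $\mathcal{P}(t)$. Let $q_r:X\to X/\mathcal{P}(r)$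 be the projection to the set of blocks. The dissimilarity on $X/\mathcal{P}(r)$ is $d_{\mathcal{P}(r)}(C_i,C_j)=\min_{x\in C_i,\,y\in C_j}d(x,y)$ (read as an infimum if the minimum is not attained). The pullback of a cover $\{V_k\}_{k}$ of $X/\mathcal{P}(r)$ along $q_r$ is $q_r^*(\{V_k\}_k)=\{q_r^{-1}(V_k)\}_k$. Families of covers $\mathcal{U}(r),\mathcal{V}(r)$ of $X$ (each increasing under refinement as $r$ grows) are $c$-approximated up to contiguity if for every $r$ there exist refinement maps $\mathcal{U}(r)\to\mathcal{V}(cr)$ and $\mathcal{V}(r)\to\mathcal{U}(cr)$. *)

theory Defs
  imports "HOL-Analysis.Analysis" "HOL-Library.Disjoint_Sets"
begin

type_synonym ('i, 'a) family = "'i set \<times> ('i \<Rightarrow> 'a set)"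

definition is_cover :: "'a set \<Rightarrow> ('i, 'a) family \<Rightarrow> bool" where
  "is_cover X U \<longleftrightarrow> X = (\<Union>i\<in>fst U. snd U i)"

definition refinement_map :: "('j, 'a) family \<Rightarrow> ('i, 'a) family \<Rightarrow> ('j \<Rightarrow> 'i) \<Rightarrow> bool" where
  "refinement_map V U f \<longleftrightarrow> f \<in> fst V \<rightarrow> fst U \<and> (\<forall>j\<in>fst V. snd V j \<subseteq> snd U (f j))"

definition is_clique :: "'a set \<Rightarrow> ('a \<Rightarrow> 'a \<Rightarrow> real) \<Rightarrow> real \<Rightarrow> 'a set \<Rightarrow> bool" where
  "is_clique Y \<delta> r M \<longleftrightarrow> M \<subseteq> Y \<and> (\<forall>x\<in>M. \<forall>y\<in>M. \<delta> x y \<le> r)"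

definition is_maximal_clique :: "'a set \<Rightarrow> ('a \<Rightarrow> 'a \<Rightarrow> real) \<Rightarrow> real \<Rightarrow> 'a set \<Rightarrow> bool" where
  "is_maximal_clique Y \<delta> r M \<longleftrightarrow> is_clique Y \<delta> r M \<and> \<not> (\<exists>N. is_clique Y \<delta> r N \<and> M \<subset> N)"

text \<open>The family of all maximal cliques is indexed by itself.\<close>

definition maximal_clique_cover :: "'a set \<Rightarrow> ('a \<Rightarrow> 'a \<Rightarrow> real) \<Rightarrow> real \<Rightarrow> ('a set, 'a) family" where
  "maximal_clique_cover Y \<delta> r = ({M. is_maximal_clique Y \<delta> r M}, \<lambda>M. M)"

text \<open>The diameter takes values in the extended nonnegative reals, so that an unbounded set has
  diameter \<open>\<infinity>\<close>; a real-valued supremum would be unspecified there.\<close>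

definition diam :: "('a \<Rightarrow> 'a \<Rightarrow> real) \<Rightarrow> 'a set \<Rightarrow> ennreal" where
  "diam d C = (SUP (x, y) \<in> C \<times> C. ennreal (d x y))"

text \<open>Only the values \<open>P r\<close> with \<open>r \<ge> 0\<close> matter.\<close>

definition persistent_clique_partition ::
    "'a set \<Rightarrow> ('a \<Rightarrow> 'a \<Rightarrow> real) \<Rightarrow> (real \<Rightarrow> 'a set set) \<Rightarrow> bool" where
  "persistent_clique_partition X d P \<longleftrightarrow>
     (\<forall>r\<ge>0. partition_on X (P r) \<and> (\<forall>C\<in>P r. diam d C \<le> ennreal r)) \<and>
     (\<forall>s t. 0 \<le> s \<and> s \<le> t \<longrightarrow> (\<forall>C\<in>P s. \<exists>D\<in>P t. C \<subseteq> D))"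

text \<open>The quotient of \<open>X\<close> by a partition \<open>Q\<close> is the set of blocks \<open>Q\<close> itself.\<close>

definition quotient_proj :: "'a set set \<Rightarrow> 'a \<Rightarrow> 'a set" where
  "quotient_proj Q x = (THE C. C \<in> Q \<and> x \<in> C)"

definition quotient_dissim :: "('a \<Rightarrow> 'a \<Rightarrow> real) \<Rightarrow> 'a set \<Rightarrow> 'a set \<Rightarrow> real" where
  "quotient_dissim d C D = (INF (x, y) \<in> C \<times> D. d x y)"

definition pullback_family :: "'a set \<Rightarrow> ('a \<Rightarrow> 'b) \<Rightarrow> ('k, 'b) family \<Rightarrow> ('k, 'a) family" where
  "pullback_family X q V = (fst V, \<lambda>k. {x \<in> X. q x \<in> snd V k})"

definition increasing_covers :: "'a set \<Rightarrow> (real \<Rightarrow> ('i, 'a) family) \<Rightarrow> bool" where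
  "increasing_covers X U \<longleftrightarrow>
     (\<forall>r\<ge>0. is_cover X (U r)) \<and>
     (\<forall>s t. 0 \<le> s \<and> s \<le> t \<longrightarrow> (\<exists>f. refinement_map (U s) (U t) f))"

definition approximated_up_to_contiguity ::
    "'a set \<Rightarrow> real \<Rightarrow> (real \<Rightarrow> ('i, 'a) family) \<Rightarrow> (real \<Rightarrow> ('j, 'a) family) \<Rightarrow> bool" where
  "approximated_up_to_contiguity X c U V \<longleftrightarrow>
     increasing_covers X U \<and> increasing_covers X V \<and>
     (\<forall>r\<ge>0. (\<exists>f. refinement_map (U r) (V (c * r)) f) \<and>
            (\<exists>g. refinement_map (V r) (U (c * r)) g))"

end

theory Submission
  imports Defs
begin

text \<open>The image in \<open>X/P(t)\<close> of a set whose points are pairwise close is a clique, and every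
  clique extends to a maximal one by Zorn's lemma; this gives \<open>M(r) \<rightarrow> M\<^sub>Q(r)\<close> and the
  monotonicity of both covers. Conversely, if two blocks of diameter at most \<open>r\<close> are at
  dissimilarity at most \<open>r\<close>, then for \<open>x\<close> in one and \<open>y\<close> in the other
  \<open>d(x,y) \<le> d(x,a) + d(a,b) + d(b,y) \<le> 2r + d(a,b)\<close>, and the infimum over \<open>a\<close> and \<open>b\<close> is at
  most \<open>3r\<close>.\<close>

text \<open>Being a clique is a condition on pairs, and any two points of the union of a chain
  already lie in one member, so Zorn's lemma applies to the cliques containing \<open>A\<close>.
  \<open>\<delta>\<close> is arbitrary because both \<open>d\<close> and the quotient dissimilarity
  are substituted for it.\<close>

lemma clique_extends_to_maximal:
  assumes "is_clique Y \<delta> r A"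
  obtains M where "is_maximal_clique Y \<delta> r M" "A \<subseteq> M"
proof -
  let ?S = "{N. is_clique Y \<delta> r N \<and> A \<subseteq> N}"
  have "\<exists>M\<in>?S. \<forall>N\<in>?S. M \<subseteq> N \<longrightarrow> N = M"
  proof (rule subset_Zorn_nonempty)
    show "?S \<noteq> {}"
      using assms by blast
    fix \<C> assume ne: "\<C> \<noteq> {}" and chain: "subset.chain ?S \<C>"
    have "\<exists>N\<in>\<C>. x \<in> N \<and> y \<in> N" if "x \<in> \<Union>\<C>" "y \<in> \<Union>\<C>" for x y
      using that chain unfolding subset_chain_def by blast
    moreover have "\<C> \<subseteq> ?S"
      using chain by (simp add: subset_chain_def)
    ultimately have "is_clique Y \<delta> r (\<Union>\<C>)"
      unfolding is_clique_def by blast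
    \<comment> \<open>Some member of the nonempty chain contains \<open>A\<close>, hence so does the
      union.\<close>
    with ne \<open>\<C> \<subseteq> ?S\<close> show "\<Union>\<C> \<in> ?S"
      by blast
  qed
  then obtain M where M: "M \<in> ?S" and max: "\<forall>N\<in>?S. M \<subseteq> N \<longrightarrow> N = M"
    by (rule bexE)
  have "\<not> M \<subset> N" if "is_clique Y \<delta> r N" for N
    using M max that by auto
  with M have "is_maximal_clique Y \<delta> r M"
    by (auto simp: is_maximal_clique_def)
  with M show thesis
    using that by blast
qed

text \<open>By the axiom of choice, a refinement map can be built one member at a time.\<close>

lemma refinement_map_exists_iff:
  "(\<exists>f. refinement_map V U f) \<longleftrightarrow> (\<forall>j\<in>fst V. \<exists>i\<in>fst U. snd V j \<subseteq> snd U i)"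
proof -
  have "(\<exists>f. refinement_map V U f) \<longleftrightarrow> (\<exists>f. \<forall>j\<in>fst V. f j \<in> fst U \<and> snd V j \<subseteq> snd U (f j))"
    by (auto simp: refinement_map_def Pi_iff)
  also have "\<dots> \<longleftrightarrow> (\<forall>j\<in>fst V. \<exists>i. i \<in> fst U \<and> snd V j \<subseteq> snd U i)"
    by (rule bchoice_iff[symmetric])
  finally show ?thesis
    by (simp add: Bex_def)
qed

lemma refinement_map_to_maximal_clique_cover:
  assumes "\<And>A. A \<in> fst V \<Longrightarrow> is_clique Y \<delta> r (snd V A)"
  shows "\<exists>f. refinement_map V (maximal_clique_cover Y \<delta> r) f"
  unfolding refinement_map_exists_iff
proof
  fix A assume A: "A \<in> fst V"
  obtain M where "is_maximal_clique Y \<delta> r M" "snd V A \<subseteq> M"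
    using clique_extends_to_maximal[OF assms[OF A]] .
  then show "\<exists>i\<in>fst (maximal_clique_cover Y \<delta> r). snd V A \<subseteq> snd (maximal_clique_cover Y \<delta> r) i"
    by (auto simp: maximal_clique_cover_def)
qed

text \<open>A subset of \<open>X\<close> lies in the preimage of a maximal clique once its image
  under \<open>q\<close> lies in that clique, so it suffices to extend the image.\<close>

lemma refinement_map_to_pullback_maximal_clique_cover:
  assumes "\<And>A. A \<in> fst V \<Longrightarrow> snd V A \<subseteq> X"
    and "\<And>A. A \<in> fst V \<Longrightarrow> is_clique Y \<delta> r (q ` snd V A)"
  shows "\<exists>f. refinement_map V (pullback_family X q (maximal_clique_cover Y \<delta> r)) f"
  unfolding refinement_map_exists_iff
proof
  fix A assume A: "A \<in> fst V"
  obtain M where "is_maximal_clique Y \<delta> r M" "q ` snd V A \<subseteq> M"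
    using clique_extends_to_maximal[OF assms(2)[OF A]] .
  then show "\<exists>i\<in>fst (pullback_family X q (maximal_clique_cover Y \<delta> r)).
      snd V A \<subseteq> snd (pullback_family X q (maximal_clique_cover Y \<delta> r)) i"
    using assms(1)[OF A] by (auto simp: pullback_family_def maximal_clique_cover_def)
qed

text \<open>The assumption makes every singleton a clique, which then extends to a maximal
  one.\<close>

lemma is_cover_maximal_clique_cover:
  assumes "\<And>x. x \<in> Y \<Longrightarrow> \<delta> x x \<le> r"
  shows "is_cover Y (maximal_clique_cover Y \<delta> r)"
proof -
  have "\<exists>M. is_maximal_clique Y \<delta> r M \<and> x \<in> M" if "x \<in> Y" for x
    using that assms clique_extends_to_maximal[of Y \<delta> r "{x}"] by (force simp: is_clique_def)
  then show ?thesis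
    by (auto simp: is_cover_def maximal_clique_cover_def is_maximal_clique_def is_clique_def)
qed

lemma is_cover_pullback_family:
  assumes "is_cover Y V" "q \<in> X \<rightarrow> Y"
  shows "is_cover X (pullback_family X q V)"
  using assms by (auto simp: is_cover_def pullback_family_def)

lemma quotient_proj_eq:
  assumes "partition_on X Q" "C \<in> Q" "x \<in> C"
  shows "quotient_proj Q x = C"
  unfolding quotient_proj_def
  using assms by (intro the_equality) (auto dest: partition_onD2 disjointD)

lemma quotient_proj_mem:
  assumes "partition_on X Q" "x \<in> X"
  shows "quotient_proj Q x \<in> Q" "x \<in> quotient_proj Q x"
  using assms quotient_proj_eq[OF assms(1)] by (auto simp: partition_on_def)

text \<open>The sign condition matters: \<open>ennreal\<close> sends negative reals to 0, so for
  negative \<open>r\<close> the left side would only bound distances by 0.\<close>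

lemma diam_le_iff:
  assumes "0 \<le> r"
  shows "diam d C \<le> ennreal r \<longleftrightarrow> (\<forall>x\<in>C. \<forall>y\<in>C. d x y \<le> r)"
  using assms by (auto simp: diam_def SUP_le_iff)

context Metric_space
begin

text \<open>Enlarging the blocks enlarges the index set of an infimum that is bounded below by 0.
  Nonemptiness avoids the unspecified real infimum of the empty set.\<close>

lemma quotient_dissim_mono:
  assumes "C \<noteq> {}" "D \<noteq> {}" "C \<subseteq> C'" "D \<subseteq> D'"
  shows "quotient_dissim d C' D' \<le> quotient_dissim d C D"
  unfolding quotient_dissim_def
  using assms by (intro cINF_superset_mono bdd_belowI2[where m = 0]) auto

lemma quotient_dissim_le:
  assumes "x \<in> C" "y \<in> D"
  shows "quotient_dissim d C D \<le> d x y"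
  \<comment> \<open>Between singletons the infimum is \<open>d x y\<close> itself.\<close>
  using quotient_dissim_mono[of "{x}" "{y}" C D] assms by (simp add: quotient_dissim_def)

lemma dist_le_quotient_dissim:
  assumes "C \<subseteq> M" "D \<subseteq> M" "diam d C \<le> ennreal r" "diam d D \<le> ennreal r" "0 \<le> r"
    and "x \<in> C" "y \<in> D"
  shows "d x y \<le> 2 * r + quotient_dissim d C D"
proof -
  \<comment> \<open>With \<open>2 * r\<close> moved to the left, the claim is that a constant is a
    lower bound of all \<open>d a b\<close>, so the infimum need not be attained.\<close>
  have "d x y - 2 * r \<le> quotient_dissim d C D"
    unfolding quotient_dissim_def
  proof (rule cINF_greatest)
    show "C \<times> D \<noteq> {}"
      using assms by blast
    fix p assume "p \<in> C \<times> D"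
    then obtain a b where p: "p = (a, b)" and ab: "a \<in> C" "b \<in> D"
      by blast
    have "d x a \<le> r" "d b y \<le> r"
      using assms ab by (auto simp: diam_le_iff)
    moreover have "d x y \<le> d x a + d a y" "d a y \<le> d a b + d b y"
      using assms ab by (auto intro!: triangle)
    ultimately show "d x y - 2 * r \<le> (case p of (x, y) \<Rightarrow> d x y)"
      by (simp add: p)
  qed
  then show ?thesis
    by simp
qed

end

theorem proposition6p3:
  fixes X :: "'a set" and d :: "'a \<Rightarrow> 'a \<Rightarrow> real" and P :: "real \<Rightarrow> 'a set set"
  assumes "Metric_space X d"
    and "persistent_clique_partition X d P"
  shows "approximated_up_to_contiguity X 3
           (\<lambda>r. maximal_clique_cover X d r)
           (\<lambda>r. pullback_family X (quotient_proj (P r))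
                  (maximal_clique_cover (P r) (quotient_dissim d) r))"
proof -
  interpret Metric_space X d by fact
  let ?q = "\<lambda>r. quotient_proj (P r)"
  let ?M = "\<lambda>r. maximal_clique_cover X d r"
  let ?MQ = "\<lambda>r. pullback_family X (?q r) (maximal_clique_cover (P r) (quotient_dissim d) r)"
  have part: "partition_on X (P r)" if "0 \<le> r" for r
    using assms(2) that by (simp add: persistent_clique_partition_def)
  have diam: "diam d C \<le> ennreal r" if "0 \<le> r" "C \<in> P r" for r C
    using assms(2) that by (simp add: persistent_clique_partition_def)
  have nested: "\<exists>D\<in>P t. C \<subseteq> D" if "0 \<le> s" "s \<le> t" "C \<in> P s" for s t C
    using assms(2) that by (simp add: persistent_clique_partition_def)
  have proj: "?q r x \<in> P r" "x \<in> ?q r x" "?q r x \<subseteq> X" if "0 \<le> r" "x \<in> X" for r x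
    using quotient_proj_mem[OF part] part that by (fastforce simp: partition_on_def)+
  have proj_mono: "?q s x \<subseteq> ?q t x" if st: "0 \<le> s" "s \<le> t" "x \<in> X" for s t x
  proof -
    obtain D where "D \<in> P t" "?q s x \<subseteq> D"
      using nested[OF st(1,2) proj(1)[OF st(1,3)]] by blast
    \<comment> \<open>\<open>D\<close> contains \<open>?q s x\<close> and hence \<open>x\<close>, so
      it is the block of \<open>x\<close> at scale \<open>t\<close>.\<close>
    moreover from this have "?q t x = D"
      using st proj(2)[of s x] by (intro quotient_proj_eq[OF part]) auto
    ultimately show ?thesis
      by simp
  qed
  have M_clique: "is_clique X d r A" if "A \<in> fst (?M r)" for r A
    using that by (simp add: maximal_clique_cover_def is_maximal_clique_def)
  have snd_M: "snd (?M r) A = A" for r A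
    by (simp add: maximal_clique_cover_def)
  have MQ_sub: "snd (?MQ r) K \<subseteq> X" for r K
    by (auto simp: pullback_family_def)
  have MQ_dissim: "quotient_dissim d (?q r x) (?q r y) \<le> r"
    if "K \<in> fst (?MQ r)" "x \<in> snd (?MQ r) K" "y \<in> snd (?MQ r) K" for r K x y
    using that by (auto simp: pullback_family_def maximal_clique_cover_def
        is_maximal_clique_def is_clique_def)
  \<comment> \<open>This is the diagonal bound that makes the maximal cliques cover the quotient;
    any point of the block gives the value 0.\<close>
  have self: "quotient_dissim d C C \<le> r" if C: "0 \<le> r" "C \<in> P r" for r C
  proof -
    have "C \<noteq> {}" "C \<subseteq> X"
      using part[OF C(1)] C(2) by (auto simp: partition_on_def)
    then obtain x where "x \<in> C" "x \<in> X"
      by blast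
    with quotient_dissim_le[of x C x C] C(1) show ?thesis
      by simp
  qed
  have "increasing_covers X ?M"
    unfolding increasing_covers_def
  proof (intro conjI allI impI)
    show "is_cover X (?M r)" if "0 \<le> r" for r
      using that by (intro is_cover_maximal_clique_cover) simp
    show "\<exists>f. refinement_map (?M s) (?M t) f" if "0 \<le> s \<and> s \<le> t" for s t
      using that M_clique[of _ s]
      by (intro refinement_map_to_maximal_clique_cover)
        (fastforce simp: snd_M is_clique_def)
  qed
  moreover have "increasing_covers X ?MQ"
    unfolding increasing_covers_def
  proof (intro conjI allI impI)
    show "is_cover X (?MQ r)" if "0 \<le> r" for r
      using that self proj
      by (intro is_cover_pullback_family[where Y = "P r"] is_cover_maximal_clique_cover) auto
    fix s t :: real assume st: "0 \<le> s \<and> s \<le> t"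
    show "\<exists>f. refinement_map (?MQ s) (?MQ t) f"
    proof (rule refinement_map_to_pullback_maximal_clique_cover[OF MQ_sub])
      fix K assume K: "K \<in> fst (?MQ s)"
      \<comment> \<open>\<open>K\<close> consists of blocks of \<open>P s\<close>, so its points are
        projected afresh to \<open>P t\<close>. Blocks only grow from \<open>s\<close> to
        \<open>t\<close>, so dissimilarities do not increase and stay at most
        \<open>s \<le> t\<close>.\<close>
      have "quotient_dissim d (?q t x) (?q t y) \<le> t"
        if xy: "x \<in> snd (?MQ s) K" "y \<in> snd (?MQ s) K" for x y
      proof -
        have X: "x \<in> X" "y \<in> X"
          using xy MQ_sub by blast+
        have "quotient_dissim d (?q t x) (?q t y) \<le> quotient_dissim d (?q s x) (?q s y)"
          using X st proj(2)[of s x] proj(2)[of s y]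
          by (intro quotient_dissim_mono proj_mono) auto
        with MQ_dissim[OF K xy] st show ?thesis
          by simp
      qed
      then show "is_clique (P t) (quotient_dissim d) t (?q t ` snd (?MQ s) K)"
        using MQ_sub proj(1)[of t] st unfolding is_clique_def by fastforce
    qed
  qed
  moreover have "\<exists>f. refinement_map (?M r) (?MQ (3 * r)) f" if r: "0 \<le> r" for r
  proof (rule refinement_map_to_pullback_maximal_clique_cover)
    fix A assume "A \<in> fst (?M r)"
    then have A: "A \<subseteq> X" "\<And>x y. x \<in> A \<Longrightarrow> y \<in> A \<Longrightarrow> d x y \<le> r"
      using M_clique unfolding is_clique_def by blast+
    then show "snd (?M r) A \<subseteq> X"
      by (simp add: snd_M)
    \<comment> \<open>The factor 3 is slack in this direction: the dissimilarity is at most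
      \<open>d x y \<le> r \<le> 3 * r\<close>.\<close>
    have "quotient_dissim d (?q (3 * r) x) (?q (3 * r) y) \<le> 3 * r" if "x \<in> A" "y \<in> A" for x y
      using quotient_dissim_le[of x "?q (3 * r) x" y "?q (3 * r) y"] A(2)[OF that] r
        proj(2)[of "3 * r"] A(1) that by fastforce
    then show "is_clique (P (3 * r)) (quotient_dissim d) (3 * r) (?q (3 * r) ` snd (?M r) A)"
      using A(1) r proj(1)[of "3 * r"] by (auto simp: is_clique_def snd_M)
  qed
  moreover have "\<exists>f. refinement_map (?MQ r) (?M (3 * r)) f" if r: "0 \<le> r" for r
  proof (rule refinement_map_to_maximal_clique_cover)
    fix K assume K: "K \<in> fst (?MQ r)"
    \<comment> \<open>Here the constant 3 arises: \<open>2 * r\<close> from the diameters of the two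
      blocks and \<open>r\<close> from their dissimilarity inside the clique
      \<open>K\<close>.\<close>
    have "d x y \<le> 3 * r" if xy: "x \<in> snd (?MQ r) K" "y \<in> snd (?MQ r) K" for x y
    proof -
      have "x \<in> X" "y \<in> X"
        using xy MQ_sub by blast+
      then have "d x y \<le> 2 * r + quotient_dissim d (?q r x) (?q r y)"
        using r proj diam by (intro dist_le_quotient_dissim) auto
      with MQ_dissim[OF K xy] show ?thesis
        by simp
    qed
    then show "is_clique X d (3 * r) (snd (?MQ r) K)"
      using MQ_sub by (simp add: is_clique_def)
  qed
  ultimately show ?thesis
    unfolding approximated_up_to_contiguity_def by blast
qed

end
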